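(* If $H$ is a graph with a conical vertex and $|H|\geq 3$, then for any integer $t\geq e(H)$, \[\operatorname{sat}_t(n,\mathfrak{R}(H))\geq \left(\frac{1}{4t^2}+o(1)\right)n\log n \quad (n\to\infty).\]
   Context: A $t$-edge-coloured graph is a graph $G$ with a function $c:E(G)\to\{1,\dots,t\}$ (not necessarily proper). A copy of $H$ is rainbow if all its edges receive distinct colours; $\mathfrak{R}(H)$ denotes the family of rainbow copies of $H$. A $t$-edge-coloured graph is $\mathfrak{R}(H)$-saturated if it contains no rainbow copy of $H$ but adding any non-edge in any colour from $\{1,\dots,t\}$ creates a rainbow copy of $H$. $\operatorname{sat}_t(n,\mathfrak{R}(H))$ is the minimum number of edges of such a graph on $n$ vertices. A vertex of $H$ is conical if its degree is $|H|-1$. Logarithms are base 2. *)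

theory Defs
  imports Complex_Main "HOL-Library.FuncSet" "HOL-Library.Landau_Symbols"
begin

record 'v graph =
  verts :: "'v set"
  edges :: "'v set set"

definition vertex_pairs :: "'v graph \<Rightarrow> 'v set set" where
  "vertex_pairs G = {e. e \<subseteq> verts G \<and> card e = 2}"

definition finite_simple_graph :: "'v graph \<Rightarrow> bool" where
  "finite_simple_graph G \<longleftrightarrow> finite (verts G) \<and> edges G \<subseteq> vertex_pairs G"

definition degree :: "'v graph \<Rightarrow> 'v \<Rightarrow> nat" where
  "degree G v = card {e \<in> edges G. v \<in> e}"

definition conical :: "'v graph \<Rightarrow> 'v \<Rightarrow> bool" where
  "conical G v \<longleftrightarrow> v \<in> verts G \<and> degree G v = card (verts G) - 1"

definition subgraph :: "'v graph \<Rightarrow> 'v graph \<Rightarrow> bool" where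
  "subgraph K G \<longleftrightarrow> finite_simple_graph K \<and> verts K \<subseteq> verts G \<and> edges K \<subseteq> edges G"

definition graph_isomorphic :: "'a graph \<Rightarrow> 'v graph \<Rightarrow> bool" where
  "graph_isomorphic H K \<longleftrightarrow>
     (\<exists>f. bij_betw f (verts H) (verts K) \<and> edges K = (\<lambda>e. f ` e) ` edges H)"

text \<open>A colouring is a total function on vertex sets; its values off the edge set are irrelevant.\<close>

definition edge_coloured :: "nat \<Rightarrow> 'v graph \<Rightarrow> ('v set \<Rightarrow> nat) \<Rightarrow> bool" where
  "edge_coloured t G c \<longleftrightarrow> finite_simple_graph G \<and> c \<in> edges G \<rightarrow> {1..t}"

text \<open>Copies are subgraphs, not necessarily induced.\<close>

definition has_rainbow_copy :: "'a graph \<Rightarrow> 'v graph \<Rightarrow> ('v set \<Rightarrow> nat) \<Rightarrow> bool" where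
  "has_rainbow_copy H G c \<longleftrightarrow>
     (\<exists>K. subgraph K G \<and> graph_isomorphic H K \<and> inj_on c (edges K))"

definition add_edge :: "'v set \<Rightarrow> 'v graph \<Rightarrow> 'v graph" where
  "add_edge e G = G\<lparr>edges := insert e (edges G)\<rparr>"

definition rainbow_saturated :: "nat \<Rightarrow> 'a graph \<Rightarrow> 'v graph \<Rightarrow> ('v set \<Rightarrow> nat) \<Rightarrow> bool" where
  "rainbow_saturated t H G c \<longleftrightarrow>
     edge_coloured t G c \<and>
     \<not> has_rainbow_copy H G c \<and>
     (\<forall>e \<in> vertex_pairs G - edges G. \<forall>i \<in> {1..t}.
        has_rainbow_copy H (add_edge e G) (c(e := i)))"

text \<open>Every finite graph is isomorphic to one with vertices in \<^typ>\<open>nat\<close>, so restricting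
  the minimum to such graphs loses nothing. The minimum is attained whenever \<open>H\<close> has an edge;
  see \<open>rainbow_saturated_exists\<close> and \<open>rainbow_sat_attained\<close> below.\<close>

definition rainbow_sat :: "nat \<Rightarrow> nat \<Rightarrow> 'a graph \<Rightarrow> nat" where
  "rainbow_sat t n H =
     (LEAST m. \<exists>(G :: nat graph) c.
        rainbow_saturated t H G c \<and> card (verts G) = n \<and> card (edges G) = m)"

lemma rainbow_saturated_exists:
  fixes H :: "'a graph" and V :: "'v set"
  assumes "edges H \<noteq> {}" and V: "finite V"
  shows "\<exists>G c. rainbow_saturated t H G c \<and> verts G = V"
proof -
  define P where "P = (\<lambda>(G :: 'v graph, c).
    edge_coloured t G c \<and> \<not> has_rainbow_copy H G c \<and> verts G = V)"
  have "P (\<lparr>verts = V, edges = {}\<rparr>, \<lambda>_. 1)"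
    using assms by (simp add: P_def edge_coloured_def finite_simple_graph_def
        has_rainbow_copy_def subgraph_def graph_isomorphic_def)
  moreover have bound: "\<forall>x. P x \<longrightarrow> card (edges (fst x)) < Suc (card (Pow V))"
  proof (intro allI impI)
    fix x assume "P x"
    then have "edges (fst x) \<subseteq> Pow V"
      by (auto simp: P_def edge_coloured_def finite_simple_graph_def vertex_pairs_def)
    then show "card (edges (fst x)) < Suc (card (Pow V))"
      using V by (simp add: card_mono less_Suc_eq_le)
  qed
  ultimately obtain x where x: "P x" "\<And>y. P y \<Longrightarrow> card (edges (fst y)) \<le> card (edges (fst x))"
    using ex_has_greatest_nat[OF _ bound] by metis
  obtain G c where Gc: "x = (G, c)" by (cases x)
  have PG: "edge_coloured t G c" "\<not> has_rainbow_copy H G c" "verts G = V"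
    using x(1) by (auto simp: P_def Gc)
  have "edges G \<subseteq> Pow V"
    using PG by (auto simp: edge_coloured_def finite_simple_graph_def vertex_pairs_def)
  then have fin: "finite (edges G)" using V by (meson finite_Pow_iff finite_subset)
  have "has_rainbow_copy H (add_edge e G) (c(e := i))"
    if e: "e \<in> vertex_pairs G - edges G" and i: "i \<in> {1..t}" for e i
  proof (rule ccontr)
    assume "\<not> ?thesis"
    moreover have "edge_coloured t (add_edge e G) (c(e := i))"
      using PG(1) e i
      by (auto simp: edge_coloured_def finite_simple_graph_def add_edge_def vertex_pairs_def Pi_iff)
    ultimately have "P (add_edge e G, c(e := i))"
      using PG(3) by (simp add: P_def add_edge_def)
    then have "card (edges (add_edge e G)) \<le> card (edges G)"
      using x(2)[of "(add_edge e G, c(e := i))"] Gc by simp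
    then show False using e fin by (simp add: add_edge_def)
  qed
  then show ?thesis
    using PG unfolding rainbow_saturated_def by blast
qed

lemma rainbow_sat_attained:
  fixes H :: "'a graph"
  assumes "edges H \<noteq> {}"
  shows "\<exists>(G :: nat graph) c. rainbow_saturated t H G c \<and> card (verts G) = n \<and>
           card (edges G) = rainbow_sat t n H"
proof -
  obtain G c where "rainbow_saturated t H G c" "verts G = {..<n}"
    using rainbow_saturated_exists[OF assms, of "{..<n}" t] by auto
  then have "\<exists>m. \<exists>(G :: nat graph) c.
      rainbow_saturated t H G c \<and> card (verts G) = n \<and> card (edges G) = m"
    by auto
  then show ?thesis unfolding rainbow_sat_def by (rule LeastI_ex)
qed

end

theory Submission
  imports Defs "HOL-Real_Asymp.Real_Asymp"
begin

text \<open>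
  Let \<open>G\<close> be saturated with \<open>n\<close> vertices and \<open>e\<close> edges. If adding a non-edge \<open>uv\<close> in colour \<open>i\<close>
  creates a rainbow copy of \<open>H\<close>, then either \<open>G\<close> contains a path \<open>uwv\<close> with two colours, or \<open>uv\<close>
  is a pendant edge of the copy at its conical vertex, \<open>u\<close> say. In the latter case \<open>G\<close> contains a
  rainbow copy of \<open>H\<close> minus a leaf, centred at \<open>u\<close> and avoiding \<open>i\<close>; then no edge at \<open>u\<close> has colour
  \<open>i\<close>, as it would complete the copy. Hence for every \<open>u\<close> some colour \<open>s\<close> excludes this case, and
  some \<open>s\<close> does so for a set \<open>X\<close> of at least \<open>n/t\<close> vertices. Any two non-adjacent vertices of
  \<open>X\<close> are joined by a two-coloured path.

  Choose a random colour \<open>r w\<close> for each vertex \<open>w\<close> and keep those \<open>v\<close> in \<open>X\<close> all of whose edges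
  \<open>vw\<close> have colour \<open>r w\<close>. The vertices kept form a clique, so there are at most \<open>1 + sqrt (2e)\<close>
  of them, whereas \<open>v\<close> is kept with probability \<open>t\<close> to the power \<open>-deg v\<close>. By convexity
  \<open>2e \<ge> (n/t) log\<^sub>t (n / (t (1 + sqrt (2e))))\<close>, so asymptotically \<open>e\<close> is at least
  \<open>n log n / (4 t log t)\<close>. Since \<open>log t < t\<close>, the error term can be taken to be zero.
\<close>

section \<open>Dominating vertices and isomorphic copies\<close>

text \<open>The adjacency form of \<open>conical\<close> can be applied edge by edge and persists
  when another vertex is deleted.\<close>

definition dominating :: "'v graph \<Rightarrow> 'v \<Rightarrow> bool" where
  "dominating K x \<longleftrightarrow> x \<in> verts K \<and> (\<forall>w \<in> verts K - {x}. {x, w} \<in> edges K)"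

text \<open>The edges at \<open>x\<close> lie among the \<open>card (verts H) - 1\<close> pairs in
  \<open>?B\<close>, so attaining that number forces equality.\<close>

lemma conical_dominating:
  assumes fin: "finite_simple_graph H" and con: "conical H x"
  shows "dominating H x"
proof -
  let ?A = "{e \<in> edges H. x \<in> e}" and ?B = "(\<lambda>w. {x, w}) ` (verts H - {x})"
  have x: "x \<in> verts H" and deg: "card ?A = card (verts H) - 1"
    using con by (auto simp: conical_def degree_def)
  have finV: "finite (verts H)"
    using fin by (simp add: finite_simple_graph_def)
  have "?A \<subseteq> ?B"
  proof
    fix e assume e: "e \<in> ?A"
    then have "e \<subseteq> verts H" "card e = 2" "x \<in> e"
      using fin by (auto simp: finite_simple_graph_def vertex_pairs_def)
    then show "e \<in> ?B"
      by (auto simp: card_2_iff)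
  qed
  moreover have "card ?B = card (verts H) - 1"
    using x finV by (subst card_image) (auto simp: inj_on_def doubleton_eq_iff)
  ultimately have "?A = ?B"
    using deg finV by (intro card_subset_eq) auto
  then show ?thesis
    using x by (auto simp: dominating_def)
qed

lemma dominating_isomorphic:
  assumes iso: "graph_isomorphic H K" and dom: "dominating H x"
  shows "\<exists>y. dominating K y"
proof -
  obtain f where f: "bij_betw f (verts H) (verts K)" "edges K = (\<lambda>e. f ` e) ` edges H"
    using iso by (auto simp: graph_isomorphic_def)
  have "{f x, w} \<in> edges K" if w: "w \<in> verts K - {f x}" for w
  proof -
    obtain v where v: "v \<in> verts H" "w = f v"
      using w bij_betw_imp_surj_on[OF f(1)] by blast
    then have "{x, v} \<in> edges H"
      using w dom by (auto simp: dominating_def)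
    then have "f ` {x, v} \<in> edges K"
      using f(2) by blast
    then show ?thesis
      using v by simp
  qed
  then have "dominating K (f x)"
    using dom f(1) by (auto simp: dominating_def bij_betw_def)
  then show ?thesis ..
qed

lemma graph_isomorphic_map:
  assumes iso: "graph_isomorphic H K" and bij: "bij_betw g (verts K) (verts L)"
    and edg: "edges L = (\<lambda>e. g ` e) ` edges K"
  shows "graph_isomorphic H L"
proof -
  obtain f where f: "bij_betw f (verts H) (verts K)" "edges K = (\<lambda>e. f ` e) ` edges H"
    using iso by (auto simp: graph_isomorphic_def)
  have "bij_betw (g \<circ> f) (verts H) (verts L)"
    using f(1) bij by (rule bij_betw_trans)
  moreover have "edges L = (\<lambda>e. (g \<circ> f) ` e) ` edges H"
    by (simp add: edg f(2) image_image image_comp)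
  ultimately show ?thesis
    unfolding graph_isomorphic_def by blast
qed

section \<open>Copies of \<open>H\<close> missing a leaf\<close>

definition add_leaf :: "'v \<Rightarrow> 'v \<Rightarrow> 'v graph \<Rightarrow> 'v graph" where
  "add_leaf u y K = \<lparr>verts = insert y (verts K), edges = insert {u, y} (edges K)\<rparr>"

text \<open>Renaming the leaf fixes \<open>K\<close> pointwise. Thus a placeholder leaf can be
  replaced by an actual neighbour of \<open>u\<close>.\<close>

lemma graph_isomorphic_change_leaf:
  assumes iso: "graph_isomorphic H (add_leaf u v K)" and K: "finite_simple_graph K"
    and u: "u \<in> verts K" and v: "v \<notin> verts K" and y: "y \<notin> verts K"
  shows "graph_isomorphic H (add_leaf u y K)"
proof (rule graph_isomorphic_map[OF iso])
  let ?g = "(\<lambda>z. z)(v := y)"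
  show "bij_betw ?g (verts (add_leaf u v K)) (verts (add_leaf u y K))"
    using v y by (auto simp: add_leaf_def bij_betw_def inj_on_def)
  have "?g ` e = e" if "e \<in> edges K" for e
  proof -
    have "v \<notin> e"
      using that K v by (auto simp: finite_simple_graph_def vertex_pairs_def)
    then show ?thesis
      by (auto simp: image_iff)
  qed
  then have "(\<lambda>e. ?g ` e) ` edges K = edges K"
    by simp
  moreover have "?g ` {u, v} = {u, y}"
    using u v by auto
  ultimately show "edges (add_leaf u y K) = (\<lambda>e. ?g ` e) ` edges (add_leaf u v K)"
    by (simp only: add_leaf_def graph.simps image_insert)
qed

text \<open>\<open>G\<close> contains a rainbow copy of \<open>H\<close> minus a leaf, centred at \<open>u\<close> and avoiding colour \<open>i\<close>.
  The vertex \<open>v\<close> stands for the missing leaf and need not lie in \<open>G\<close>.\<close>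

definition almost_copy :: "'a graph \<Rightarrow> 'v graph \<Rightarrow> ('v set \<Rightarrow> nat) \<Rightarrow> nat \<Rightarrow> 'v \<Rightarrow> bool" where
  "almost_copy H G c i u \<longleftrightarrow>
     (\<exists>K v. subgraph K G \<and> dominating K u \<and> inj_on c (edges K) \<and> i \<notin> c ` edges K \<and>
        v \<notin> verts K \<and> graph_isomorphic H (add_leaf u v K))"

text \<open>An edge at \<open>u\<close> of colour \<open>i\<close> cannot end inside
  \<open>K\<close>, because \<open>u\<close> is joined to the rest of \<open>K\<close> by edges
  avoiding \<open>i\<close>. It would therefore leave \<open>K\<close> and complete a rainbow
  copy.\<close>

lemma almost_copy_colour:
  assumes G: "finite_simple_graph G" and free: "\<not> has_rainbow_copy H G c"
    and alm: "almost_copy H G c i u" and e: "{u, x} \<in> edges G"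
  shows "c {u, x} \<noteq> i"
proof
  assume i: "c {u, x} = i"
  obtain K v where K: "subgraph K G" "dominating K u" "inj_on c (edges K)" "i \<notin> c ` edges K"
    and v: "v \<notin> verts K" "graph_isomorphic H (add_leaf u v K)"
    using alm by (auto simp: almost_copy_def)
  have ux: "u \<noteq> x" "x \<in> verts G" "u \<in> verts G"
    using G e by (auto simp: finite_simple_graph_def vertex_pairs_def)
  have x: "x \<notin> verts K"
    using K(2,4) i ux(1) by (auto simp: dominating_def)
  have "graph_isomorphic H (add_leaf u x K)"
    using graph_isomorphic_change_leaf[OF v(2) _ _ v(1) x] K(1,2)
    by (simp add: subgraph_def dominating_def)
  moreover have "subgraph (add_leaf u x K) G"
    using K(1,2) ux e
    by (auto simp: subgraph_def add_leaf_def finite_simple_graph_def vertex_pairs_def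
        dominating_def)
  moreover have "inj_on c (edges (add_leaf u x K))"
    using K(3,4) i by (auto simp: add_leaf_def)
  ultimately show False
    using free by (auto simp: has_rainbow_copy_def)
qed

text \<open>An almost copy at \<open>u\<close> has at least two vertices, hence an edge at
  \<open>u\<close>, and the colour of that edge is excluded by \<open>almost_copy_colour\<close>.
  Colour 1 serves only as a first trial.\<close>

lemma almost_copy_not_all_colours:
  assumes G: "edge_coloured t G c" and free: "\<not> has_rainbow_copy H G c"
    and H: "card (verts H) \<ge> 3" and t: "t \<ge> 1"
  shows "\<exists>i \<in> {1..t}. \<not> almost_copy H G c i u"
proof (cases "almost_copy H G c 1 u")
  case False
  then show ?thesis using t by auto
next
  case True
  then obtain K v where K: "subgraph K G" "dominating K u"
    and v: "v \<notin> verts K" "graph_isomorphic H (add_leaf u v K)"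
    by (auto simp: almost_copy_def)
  have "card (verts H) = card (insert v (verts K))"
    using v(2) by (auto simp: graph_isomorphic_def add_leaf_def dest: bij_betw_same_card)
  then have "card (verts K) \<ge> 2"
    using H v(1) K(1) by (simp add: subgraph_def finite_simple_graph_def)
  then have "\<not> verts K \<subseteq> {u}"
    using card_mono[of "{u}" "verts K"] by auto
  then obtain w where "w \<in> verts K - {u}" by auto
  then have e: "{u, w} \<in> edges G"
    using K by (auto simp: dominating_def subgraph_def)
  then have "\<not> almost_copy H G c (c {u, w}) u"
    using almost_copy_colour[OF _ free _ e] G by (auto simp: edge_coloured_def)
  moreover have "c {u, w} \<in> {1..t}"
    using G e by (auto simp: edge_coloured_def)
  ultimately show ?thesis by blast
qed

lemma inj_on_fun_upd_Diff:
  assumes "inj_on (f(a := b)) A"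
  shows "inj_on f (A - {a})"
proof -
  have "inj_on (f(a := b)) (A - {a})"
    using assms by (rule inj_on_subset) auto
  then show ?thesis
    by (subst inj_on_cong[of _ _ "f(a := b)"]) auto
qed

text \<open>Deleting the pendant vertex \<open>v\<close> removes the one edge that was added and
  recoloured. Since that edge had colour \<open>i\<close>, the rest of the rainbow copy avoids
  \<open>i\<close>.\<close>

lemma almost_copy_of_leaf:
  assumes K: "subgraph K (add_edge {u, v} G)" "graph_isomorphic H K"
      "inj_on (c({u, v} := i)) (edges K)"
    and uv: "u \<noteq> v" "{u, v} \<in> edges K"
    and dom: "dominating K u" and leaf: "\<And>e. e \<in> edges K \<Longrightarrow> v \<in> e \<Longrightarrow> e = {u, v}"
  shows "almost_copy H G c i u"
proof -
  let ?K = "\<lparr>verts = verts K - {v}, edges = edges K - {{u, v}}\<rparr>"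
  have vK: "v \<in> verts K"
    using K(1) uv by (auto simp: subgraph_def finite_simple_graph_def vertex_pairs_def)
  then have "add_leaf u v ?K = K"
    using uv by (simp add: add_leaf_def insert_absorb)
  moreover have "subgraph ?K G"
    using K(1) leaf by (auto simp: subgraph_def finite_simple_graph_def vertex_pairs_def add_edge_def)
  moreover have "dominating ?K u"
    using dom uv(1) by (auto simp: dominating_def doubleton_eq_iff)
  moreover have "inj_on c (edges ?K)"
    using inj_on_fun_upd_Diff[OF K(3)] by simp
  moreover have "i \<notin> c ` edges ?K"
  proof
    assume "i \<in> c ` edges ?K"
    then obtain e where e: "e \<in> edges K" "e \<noteq> {u, v}" "c e = i" by auto
    then have "(c({u, v} := i)) e = (c({u, v} := i)) {u, v}" by simp
    then show False
      using K(3) e uv(2) by (blast dest: inj_onD)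
  qed
  ultimately show ?thesis
    using K(2) unfolding almost_copy_def by (intro exI[of _ ?K] exI[of _ v]) simp
qed

text \<open>The new copy \<open>K\<close> uses \<open>uv\<close> and has a dominating vertex
  \<open>x\<close>. If \<open>x\<close> is neither end, it is the midpoint \<open>w\<close>. If it
  is one end, the other end has a second edge in \<open>K\<close>, as otherwise
  \<open>almost_copy\<close> would hold; the far end of that edge is adjacent to \<open>x\<close>
  and serves as \<open>w\<close>.\<close>

lemma saturated_rainbow_path:
  assumes H: "dominating H h" and sat: "rainbow_saturated t H G c"
    and uv: "u \<in> verts G" "v \<in> verts G" "u \<noteq> v" "{u, v} \<notin> edges G"
    and i: "i \<in> {1..t}" "\<not> almost_copy H G c i u" "\<not> almost_copy H G c i v"
  shows "\<exists>w. {u, w} \<in> edges G \<and> {v, w} \<in> edges G \<and> c {u, w} \<noteq> c {v, w}"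
proof -
  have "{u, v} \<in> vertex_pairs G - edges G"
    using uv by (auto simp: vertex_pairs_def)
  then have "has_rainbow_copy H (add_edge {u, v} G) (c({u, v} := i))"
    using sat i(1) by (auto simp: rainbow_saturated_def)
  then obtain K where K: "subgraph K (add_edge {u, v} G)" "graph_isomorphic H K"
      "inj_on (c({u, v} := i)) (edges K)"
    by (auto simp: has_rainbow_copy_def)
  have simple: "e \<subseteq> verts K" "card e = 2" if "e \<in> edges K" for e
    using that K(1) by (auto simp: subgraph_def finite_simple_graph_def vertex_pairs_def)
  have uvK: "{u, v} \<in> edges K"
  proof (rule ccontr)
    assume n: "{u, v} \<notin> edges K"
    then have "subgraph K G"
      using K(1) by (auto simp: subgraph_def add_edge_def)
    moreover have "inj_on c (edges K)"
      using inj_on_fun_upd_Diff[OF K(3)] n by simp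
    ultimately show False
      using sat K(2) by (auto simp: rainbow_saturated_def has_rainbow_copy_def)
  qed
  have path: ?thesis if "{u, w} \<in> edges K" "{v, w} \<in> edges K" for w
  proof -
    have ne: "w \<noteq> u" "w \<noteq> v"
      using simple[OF that(1)] simple[OF that(2)] by auto
    then have ne2: "{u, w} \<noteq> {u, v}" "{v, w} \<noteq> {u, v}" "{u, w} \<noteq> {v, w}"
      using uv(3) by (auto simp: doubleton_eq_iff)
    then have "{u, w} \<in> edges G" "{v, w} \<in> edges G"
      using that K(1) by (auto simp: subgraph_def add_edge_def)
    moreover have "c {u, w} \<noteq> c {v, w}"
      using inj_onD[OF K(3) _ that] ne2 by auto
    ultimately show ?thesis by blast
  qed
  have centre: ?thesis
    if a: "dominating K a" "{a, b} = {u, v}" and nalm: "\<not> almost_copy H G c i a" for a b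
  proof -
    have ab: "a \<noteq> b" using a(2) uv(3) by auto
    obtain e where e: "e \<in> edges K" "b \<in> e" "e \<noteq> {a, b}"
      using almost_copy_of_leaf[of K a b G H c i] K uvK ab a nalm by auto
    obtain w where w: "e = {b, w}" "w \<noteq> b"
      using simple(2)[OF e(1)] e(2) by (auto simp: card_2_iff)
    then have "w \<in> verts K - {a}"
      using simple(1)[OF e(1)] e(3) by auto
    then have "{a, w} \<in> edges K"
      using a(1) by (auto simp: dominating_def)
    moreover have "{b, w} \<in> edges K" using e w by simp
    ultimately show ?thesis
      using path[of w] a(2) by (auto simp: doubleton_eq_iff)
  qed
  obtain x where x: "dominating K x"
    using dominating_isomorphic[OF K(2) H] by auto
  show ?thesis
  proof (cases "x \<in> {u, v}")
    case True
    then show ?thesis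
      using centre[of u v] centre[of v u] x i by auto
  next
    case False
    then have "{x, u} \<in> edges K" "{x, v} \<in> edges K"
      using x simple(1)[OF uvK] by (auto simp: dominating_def)
    then show ?thesis
      using path[of x] by (simp add: insert_commute)
  qed
qed

section \<open>Random filtering and convexity\<close>

text \<open>The sum is the expected number of elements of \<open>X\<close> surviving a uniformly random \<open>r\<close>.\<close>

lemma sum_inverse_power_degree_le:
  fixes nb :: "'a \<Rightarrow> 'b set" and col :: "'a \<Rightarrow> 'b \<Rightarrow> 'c"
  assumes V: "finite V" and X: "finite X" and C: "finite C" "C \<noteq> {}"
    and nb: "\<And>v. v \<in> X \<Longrightarrow> nb v \<subseteq> V"
    and col: "\<And>v w. v \<in> X \<Longrightarrow> w \<in> nb v \<Longrightarrow> col v w \<in> C"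
    and bound: "\<And>r. r \<in> V \<rightarrow>\<^sub>E C \<Longrightarrow>
      real (card {v \<in> X. \<forall>w \<in> nb v. r w = col v w}) \<le> m"
  shows "(\<Sum>v \<in> X. (1 / real (card C)) ^ card (nb v)) \<le> m"
proof -
  let ?F = "V \<rightarrow>\<^sub>E C" and ?t = "real (card C)"
  have t: "?t > 0" using C by (simp add: card_gt_0_iff)
  have finF: "finite ?F" using V C by (intro finite_PiE) auto
  have cF: "real (card ?F) = ?t ^ card V" using V by (simp add: card_PiE)
  \<comment> \<open>The values of \<open>r\<close> are forced on \<open>nb v\<close> and free
    elsewhere.\<close>
  have count: "real (card {r \<in> ?F. \<forall>w \<in> nb v. r w = col v w}) =
      ?t ^ card V * (1 / ?t) ^ card (nb v)" if v: "v \<in> X" for v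
  proof -
    have "{r \<in> ?F. \<forall>w \<in> nb v. r w = col v w} =
        (\<Pi>\<^sub>E w \<in> V. if w \<in> nb v then {col v w} else C)"
      using nb[OF v] col[OF v] by (fastforce simp: PiE_iff split: if_splits)
    moreover have "card \<dots> = (\<Prod>w \<in> V. if w \<in> nb v then 1 else card C)"
      using V by (simp add: card_PiE) (intro prod.cong; simp)
    moreover have "\<dots> = card C ^ card (V - nb v)"
      using V by (simp add: prod.If_cases Diff_eq)
    moreover have "card V = card (V - nb v) + card (nb v)"
      using nb[OF v] V by (metis card_Diff_subset card_mono finite_subset le_add_diff_inverse2)
    ultimately show ?thesis
      using t by (simp add: power_add power_one_over)
  qed
  \<comment> \<open>Double counting of the pairs of \<open>v\<close> and a colouring
    \<open>r\<close> that keeps it.\<close>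
  have "?t ^ card V * (\<Sum>v \<in> X. (1 / ?t) ^ card (nb v)) =
      (\<Sum>v \<in> X. \<Sum>r \<in> ?F. if \<forall>w \<in> nb v. r w = col v w then 1 else 0)"
    using count finF by (simp add: sum_distrib_left sum.If_cases Int_def)
  also have "\<dots> = (\<Sum>r \<in> ?F. \<Sum>v \<in> X. if \<forall>w \<in> nb v. r w = col v w then 1 else 0)"
    by (rule sum.swap)
  also have "\<dots> = (\<Sum>r \<in> ?F. real (card {v \<in> X. \<forall>w \<in> nb v. r w = col v w}))"
    using X by (simp add: sum.If_cases Int_def)
  also have "\<dots> \<le> (\<Sum>r \<in> ?F. m)"
    using bound by (intro sum_mono) auto
  also have "\<dots> = ?t ^ card V * m" by (simp add: cF)
  finally show ?thesis using t by simp
qed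

text \<open>Jensen's inequality for the exponential, via the tangent at the point \<open>k\<close>
  where \<open>card X = m * t powr k\<close>.\<close>

lemma sum_degree_ge_of_sum_inverse_power_le:
  fixes t m :: real and d :: "'a \<Rightarrow> nat"
  assumes X: "finite X" "X \<noteq> {}" and t: "t > 1" and m: "m > 0"
    and le: "(\<Sum>v \<in> X. (1 / t) ^ d v) \<le> m"
  shows "(\<Sum>v \<in> X. real (d v)) \<ge> real (card X) * log t (real (card X) / m)"
proof -
  define N where "N = real (card X)"
  define k where "k = log t (N / m)"
  have N: "N > 0" using X by (simp add: N_def card_gt_0_iff)
  have tk: "t powr k = N / m" using t m N by (simp add: k_def)
  have "1 + ln t * (k - real (d v)) \<le> N / m * (1 / t) ^ d v" for v
  proof -
    have "1 + ln t * (k - real (d v)) \<le> exp (ln t * (k - real (d v)))"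
      by (rule exp_ge_add_one_self)
    also have "\<dots> = t powr (k - real (d v))"
      using t by (simp add: powr_def mult.commute)
    also have "\<dots> = N / m * (1 / t) ^ d v"
      using t by (simp add: powr_diff tk powr_realpow power_one_over)
    finally show ?thesis .
  qed
  then have "(\<Sum>v \<in> X. 1 + ln t * (k - real (d v))) \<le> (\<Sum>v \<in> X. N / m * (1 / t) ^ d v)"
    by (intro sum_mono)
  also have "\<dots> = N / m * (\<Sum>v \<in> X. (1 / t) ^ d v)"
    by (simp add: sum_distrib_left)
  also have "\<dots> \<le> N / m * m"
    using le N m by (intro mult_left_mono) auto
  \<comment> \<open>By the choice of \<open>k\<close> the right side is \<open>N\<close>, which
    cancels the sum of the ones on the left.\<close>
  finally have "N + ln t * (N * k - (\<Sum>v \<in> X. real (d v))) \<le> N"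
    using m by (simp add: sum.distrib sum_subtractf N_def flip: sum_distrib_left)
  then have "ln t * (N * k - (\<Sum>v \<in> X. real (d v))) \<le> 0" by simp
  then have "N * k - (\<Sum>v \<in> X. real (d v)) \<le> 0"
    using t by (simp add: mult_le_0_iff)
  then show ?thesis by (simp add: N_def k_def)
qed

section \<open>Degrees and cliques\<close>

lemma card_neighbours:
  assumes "finite_simple_graph G"
  shows "card {w. {v, w} \<in> edges G} = degree G v"
proof -
  have "{e \<in> edges G. v \<in> e} = (\<lambda>w. {v, w}) ` {w. {v, w} \<in> edges G}"
  proof (intro equalityI subsetI)
    fix e assume e: "e \<in> {e \<in> edges G. v \<in> e}"
    then have "card e = 2" "v \<in> e"
      using assms by (auto simp: finite_simple_graph_def vertex_pairs_def)
    then obtain w where "e = {v, w}" by (auto simp: card_2_iff)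
    then show "e \<in> (\<lambda>w. {v, w}) ` {w. {v, w} \<in> edges G}" using e by auto
  qed auto
  moreover have "inj_on (\<lambda>w. {v, w}) A" for A
    by (auto simp: inj_on_def doubleton_eq_iff)
  ultimately show ?thesis
    by (simp add: degree_def card_image)
qed

lemma finite_edges:
  assumes "finite_simple_graph G"
  shows "finite (edges G)"
  using assms by (auto simp: finite_simple_graph_def vertex_pairs_def
      intro: finite_subset[of _ "Pow (verts G)"])

lemma sum_degree:
  assumes G: "finite_simple_graph G"
  shows "(\<Sum>v \<in> verts G. degree G v) = 2 * card (edges G)"
proof -
  have fin: "finite (verts G)" "finite (edges G)"
    using G finite_edges by (auto simp: finite_simple_graph_def)
  have "(\<Sum>v \<in> verts G. degree G v) = (\<Sum>v \<in> verts G. \<Sum>e \<in> edges G. if v \<in> e then 1 else 0)"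
    using fin by (simp add: degree_def sum.If_cases Int_def)
  also have "\<dots> = (\<Sum>e \<in> edges G. \<Sum>v \<in> verts G. if v \<in> e then 1 else 0)"
    by (rule sum.swap)
  also have "\<dots> = (\<Sum>e \<in> edges G. 2)"
  proof (rule sum.cong)
    fix e assume "e \<in> edges G"
    then have "verts G \<inter> e = e" "card e = 2"
      using G by (auto simp: finite_simple_graph_def vertex_pairs_def)
    then show "(\<Sum>v \<in> verts G. if v \<in> e then 1 else 0) = (2::nat)"
      using fin by (simp add: sum.If_cases)
  qed simp
  finally show ?thesis by simp
qed

text \<open>A clique on \<open>s\<close> vertices spans \<open>s * (s - 1) / 2\<close> edges, which
  is at least half of \<open>(s - 1)\<close> squared.\<close>

lemma card_clique_le:
  assumes G: "finite_simple_graph G" and S: "finite S"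
    and clique: "\<And>u v. u \<in> S \<Longrightarrow> v \<in> S \<Longrightarrow> u \<noteq> v \<Longrightarrow> {u, v} \<in> edges G"
  shows "real (card S) \<le> 1 + sqrt (2 * real (card (edges G)))"
proof (cases "S = {}")
  case False
  then have pos: "card S \<ge> 1" using S by (simp add: Suc_leI card_gt_0_iff)
  have "{e. e \<subseteq> S \<and> card e = 2} \<subseteq> edges G"
    using clique by (auto simp: card_2_iff)
  then have "card S choose 2 \<le> card (edges G)"
    using n_subsets[OF S, of 2] card_mono[OF finite_edges[OF G]] by metis
  \<comment> \<open>\<open>choose_two\<close> divides in the naturals; parity makes this division
    exact.\<close>
  moreover have "even (card S * (card S - 1))"
    using pos by simp
  then obtain k where "card S * (card S - 1) = 2 * k" ..
  ultimately have "card S * (card S - 1) \<le> 2 * card (edges G)"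
    by (simp add: choose_two)
  moreover have "(card S - 1) * (card S - 1) \<le> card S * (card S - 1)"
    by (intro mult_right_mono) auto
  ultimately have "(card S - 1)\<^sup>2 \<le> 2 * card (edges G)"
    unfolding power2_eq_square by linarith
  then have "real ((card S - 1)\<^sup>2) \<le> real (2 * card (edges G))"
    by (simp only: of_nat_le_iff)
  then have "(real (card S) - 1)\<^sup>2 \<le> 2 * real (card (edges G))"
    using pos by simp
  then show ?thesis using real_le_rsqrt by force
qed simp

section \<open>The implicit bound for saturated graphs\<close>

text \<open>The clique bound leaves \<open>e\<close> inside the logarithm as well; the asymptotic
  argument resolves this.\<close>

lemma rainbow_saturated_edges_ge:
  fixes G :: "'v graph"
  assumes H: "dominating H h" "card (verts H) \<ge> 3" and t: "t \<ge> 2"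
    and sat: "rainbow_saturated t H G c" and ne: "verts G \<noteq> {}"
  defines "e \<equiv> real (card (edges G))" and "n \<equiv> real (card (verts G))"
  shows "2 * e \<ge> n / t * log t (n / t / (1 + sqrt (2 * e)))"
proof -
  have col: "edge_coloured t G c" and free: "\<not> has_rainbow_copy H G c"
    using sat by (auto simp: rainbow_saturated_def)
  have G: "finite_simple_graph G" using col by (simp add: edge_coloured_def)
  have finV: "finite (verts G)" using G by (simp add: finite_simple_graph_def)
  define X where "X s = {v \<in> verts G. \<not> almost_copy H G c s v}" for s
  have cover: "verts G \<subseteq> (\<Union>s \<in> {1..t}. X s)"
    using almost_copy_not_all_colours[OF col free H(2)] t by (fastforce simp: X_def)
  obtain s where s: "s \<in> {1..t}" "n / t \<le> real (card (X s))"
  proof (rule ccontr)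
    assume "\<not> thesis"
    then have less: "\<And>s. s \<in> {1..t} \<Longrightarrow> real (card (X s)) < n / t"
      using that by fastforce
    have "card (verts G) \<le> card (\<Union>s \<in> {1..t}. X s)"
      using finV by (intro card_mono cover) (auto simp: X_def)
    also have "\<dots> \<le> (\<Sum>s = 1..t. card (X s))"
      by (rule card_UN_le) simp
    finally have "n \<le> (\<Sum>s = 1..t. real (card (X s)))"
      unfolding n_def by (simp flip: of_nat_sum)
    also have "\<dots> < (\<Sum>s = 1..t. n / t)"
      using t less by (intro sum_strict_mono) auto
    also have "\<dots> = n" using t by simp
    finally show False by simp
  qed
  have npos: "n > 0" using ne finV by (simp add: n_def card_gt_0_iff)
  have XV: "X s \<subseteq> verts G" "finite (X s)" using finV by (auto simp: X_def)
  have Xne: "X s \<noteq> {}" using s(2) npos t by (auto simp: divide_le_0_iff)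
  define m where "m = 1 + sqrt (2 * e)"
  have m: "m > 0" by (simp add: m_def e_def add_pos_nonneg)
  have "(\<Sum>v \<in> X s. (1 / real (card {1..t})) ^ card {w. {v, w} \<in> edges G}) \<le> m"
  proof (rule sum_inverse_power_degree_le[where V = "verts G" and col = "\<lambda>v w. c {v, w}"])
    fix r assume "r \<in> verts G \<rightarrow>\<^sub>E {1..t}"
    show "real (card {v \<in> X s. \<forall>w \<in> {w. {v, w} \<in> edges G}. r w = c {v, w}}) \<le> m"
      unfolding m_def e_def
    proof (rule card_clique_le[OF G])
      fix u v
      assume uv: "u \<in> {v \<in> X s. \<forall>w \<in> {w. {v, w} \<in> edges G}. r w = c {v, w}}"
        "v \<in> {v \<in> X s. \<forall>w \<in> {w. {v, w} \<in> edges G}. r w = c {v, w}}" "u \<noteq> v"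
      show "{u, v} \<in> edges G"
      proof (rule ccontr)
        assume "{u, v} \<notin> edges G"
        then obtain w where "{u, w} \<in> edges G" "{v, w} \<in> edges G" "c {u, w} \<noteq> c {v, w}"
          using saturated_rainbow_path[OF H(1) sat _ _ uv(3) _ s(1)] uv by (auto simp: X_def)
        \<comment> \<open>Both \<open>u\<close> and \<open>v\<close> are kept, so both colours equal
          \<open>r w\<close>.\<close>
        then show False using uv by auto
      qed
    qed (use XV in auto)
  next
    fix v w assume "v \<in> X s" "w \<in> {w. {v, w} \<in> edges G}"
    then show "c {v, w} \<in> {1..t}" using col by (auto simp: edge_coloured_def)
  next
    fix v
    show "{w. {v, w} \<in> edges G} \<subseteq> verts G"
      using G by (auto simp: finite_simple_graph_def vertex_pairs_def)
  qed (use t finV XV in auto)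
  then have "(\<Sum>v \<in> X s. (1 / real t) ^ degree G v) \<le> m"
    by (simp add: card_neighbours[OF G])
  then have "real (card (X s)) * log t (real (card (X s)) / m) \<le> (\<Sum>v \<in> X s. real (degree G v))"
    using XV Xne t m by (intro sum_degree_ge_of_sum_inverse_power_le) auto
  also have "\<dots> \<le> (\<Sum>v \<in> verts G. real (degree G v))"
    using XV finV by (intro sum_mono2) auto
  also have "\<dots> = 2 * e"
    using sum_degree[OF G] by (simp add: e_def flip: of_nat_sum)
  finally have le: "real (card (X s)) * log t (real (card (X s)) / m) \<le> 2 * e" .
  show ?thesis
  \<comment> \<open>Replacing \<open>card (X s)\<close> by the smaller \<open>n / t\<close> in the
    outer factor requires a nonnegative logarithm; otherwise the claim is trivial.\<close>
  proof (cases "log t (n / t / m) \<le> 0")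
    case True
    then have "n / t * log t (n / t / m) \<le> 0"
      using npos by (intro mult_nonneg_nonpos) auto
    then show ?thesis by (simp add: m_def e_def)
  next
    case False
    have "log t (n / t / m) \<le> log t (real (card (X s)) / m)"
      using s(2) npos t m by (intro log_mono divide_right_mono) auto
    then have "n / t * log t (n / t / m) \<le> real (card (X s)) * log t (real (card (X s)) / m)"
      using False s(2) by (intro mult_mono) auto
    then show ?thesis using le by (simp add: m_def)
  qed
qed

section \<open>Asymptotics\<close>

text \<open>The quotient is of order \<open>sqrt (n / log 2 n)\<close>, so its logarithm is
  asymptotically half of \<open>log 2 n\<close>.\<close>

lemma eventually_log_quotient_gt:
  fixes a t :: real
  assumes a: "a < 1 / 2" and t: "t > 0"
  shows "\<forall>\<^sub>F n :: nat in sequentially.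
    a * log 2 n < log 2 (n / t / (1 + sqrt (n * log 2 n)))"
proof -
  have "(\<lambda>n :: nat. log 2 (n / t / (1 + sqrt (n * log 2 n))) / log 2 n) \<longlonglongrightarrow> 1 / 2"
    using t by real_asymp
  then have "\<forall>\<^sub>F n in sequentially.
      a < log 2 (real n / t / (1 + sqrt (n * log 2 n))) / log 2 n"
    using a by (rule order_tendstoD)
  moreover have "\<forall>\<^sub>F n :: nat in sequentially. log 2 n > 0" by real_asymp
  ultimately show ?thesis
    by eventually_elim (simp add: pos_less_divide_eq)
qed

theorem theorem2p3:
  fixes H :: "'a graph" and t :: nat
  assumes "finite_simple_graph H"
    and "\<exists>v. conical H v"
    and "card (verts H) \<ge> 3"
    and "t \<ge> card (edges H)"
  shows "\<exists>\<epsilon> :: nat \<Rightarrow> real. \<epsilon> \<in> o(\<lambda>n. 1) \<and>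
           (\<forall>\<^sub>F n in sequentially.
              real (rainbow_sat t n H) \<ge> (1 / (4 * (real t)\<^sup>2) + \<epsilon> n) * real n * log 2 (real n))"
proof -
  obtain h where h: "conical H h" using assms(2) by auto
  have dom: "dominating H h" using conical_dominating[OF assms(1) h] .
  \<comment> \<open>This yields \<open>t \<ge> 2\<close>, making base \<open>t\<close> legitimate,
    and an edge of \<open>H\<close>, so that the minimum is attained.\<close>
  have "2 \<le> degree H h" using h assms(3) by (simp add: conical_def)
  also have "\<dots> \<le> card (edges H)"
    unfolding degree_def by (intro card_mono finite_edges assms(1)) auto
  finally have e2: "2 \<le> card (edges H)" .
  then have t: "t \<ge> 2" and ne: "edges H \<noteq> {}" using assms(4) by auto
  then have tpos: "real t > 0" by simp
  \<comment> \<open>The resulting strict inequality \<open>log 2 t < t\<close> is the slack that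
    puts \<open>a\<close> below \<open>1 / 2\<close>.\<close>
  have "t < 2 ^ t" by (rule less_exp)
  then have "log 2 t < log 2 (2 ^ t)" using t by (subst log_less_cancel_iff) (auto simp flip: of_nat_less_iff)
  then have lt: "log 2 t < t" by simp
  have l0: "log 2 t > 0" using t by simp
  \<comment> \<open>In base \<open>t\<close>, \<open>a * log 2 n\<close> becomes
    \<open>log 2 n / (2 * t)\<close>; multiplying by \<open>n / t\<close> gives exactly twice the
    target for \<open>e\<close>.\<close>
  define a where "a = log 2 t / (2 * real t)"
  have a: "a < 1 / 2" using lt t by (simp add: a_def field_simps)
  have "\<forall>\<^sub>F n in sequentially. real (rainbow_sat t n H) \<ge> 1 / (4 * (real t)\<^sup>2) * real n * log 2 (real n)"
    using eventually_log_quotient_gt[OF a tpos] eventually_ge_at_top[of 2]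
  proof eventually_elim
    case (elim n)
    obtain G :: "nat graph" and c where G: "rainbow_saturated t H G c" "card (verts G) = n"
      "card (edges G) = rainbow_sat t n H"
      using rainbow_sat_attained[OF ne] by blast
    define e where "e = real (rainbow_sat t n H)"
    define L where "L = log 2 (real n)"
    have L: "L > 0" using elim by (simp add: L_def)
    show ?case
    proof (rule ccontr)
      assume "\<not> ?thesis"
      then have less: "e < 1 / (4 * (real t)\<^sup>2) * (real n * L)"
        by (simp add: e_def L_def mult.assoc)
      \<comment> \<open>The assumed upper bound on \<open>e\<close> is first weakened to
        \<open>2 * e \<le> n * L\<close>, which suffices inside the logarithm.\<close>
      have "4 \<le> (real t)\<^sup>2" using power_mono[of 2 "real t" 2] t by simp
      then have "1 / (4 * (real t)\<^sup>2) * (real n * L) \<le> 1 / 2 * (real n * L)"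
        using L frac_le[of 1 1 2 "4 * (real t)\<^sup>2"] by (intro mult_right_mono) auto
      then have e_le: "2 * e \<le> real n * L" using less by linarith
      have e0: "e \<ge> 0" by (simp add: e_def)
      have "a * L < log 2 (n / t / (1 + sqrt (n * L)))" using elim t by (simp add: L_def)
      also have "\<dots> \<le> log 2 (n / t / (1 + sqrt (2 * e)))"
        using e_le e0 elim t L by (intro log_mono divide_left_mono) (auto intro!: add_pos_nonneg mult_pos_pos divide_pos_pos)
      also have "\<dots> = log 2 t * log t (n / t / (1 + sqrt (2 * e)))"
        using t elim by (simp add: log_def)
      finally have "log 2 t * (L / (2 * t)) < log 2 t * log t (n / t / (1 + sqrt (2 * e)))"
        by (simp add: a_def)
      then have "L / (2 * t) < log t (n / t / (1 + sqrt (2 * e)))"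
        using l0 by (simp only: mult_less_cancel_left_pos)
      then have "n / t * (L / (2 * t)) < n / t * log t (n / t / (1 + sqrt (2 * e)))"
        using t elim by (intro mult_strict_left_mono) auto
      also have "\<dots> \<le> 2 * e"
        using rainbow_saturated_edges_ge[OF dom assms(3) t G(1)] G(2,3) elim
        by (force simp: e_def)
      finally show False using less t by (simp add: field_simps power2_eq_square)
    qed
  qed
  then show ?thesis by (intro exI[of _ "\<lambda>_. 0"]) simp
qed

end
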